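(* As an identity of formal power series in $x,y,q$, \begin{align*} &(-xq;q^2)_\infty (-yq^2;q^4)_\infty\\ &\quad= \sum_{n_1,n_2,n_3,n_4\ge 0}\frac{x^{n_1+n_2+2n_4}y^{n_2+n_3}q^{n_1+3n_2+2n_3+4n_4}\left(1+x^2yq^{6+8(n_1+n_2+n_3+n_4)}\right)}{(q^2;q^2)_{n_1}(q^2;q^2)_{n_2}(q^4;q^4)_{n_3}(q^4;q^4)_{n_4}}\\ &\quad\quad\times q^{4\binom{n_1}{2}+6\binom{n_2}{2}+4\binom{n_3}{2}+8\binom{n_4}{2}+4n_1n_2+4n_1n_3+4n_1n_4+4n_2n_3+4n_2n_4+4n_3n_4}. \end{align*}
   Context: For $n\in\mathbb{N}\cup\{\infty\}$, $(A;q)_n:=\prod_{k=0}^{n-1}(1-Aq^k)$ (the $q$-Pochhammer symbol). *)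

theory Defs
  imports
    "HOL-Analysis.Analysis"
    "HOL-Computational_Algebra.Formal_Power_Series"
    "HOL-Library.Extended_Nat"
begin

text \<open>
  The ring of formal power series in \<open>x\<close>, \<open>y\<close>, \<open>q\<close> over a field \<open>K\<close> is rendered as the iterated
  power series ring \<open>K[[x]][[y]][[q]]\<close>.  The variable \<open>q\<close> is the outermost one on purpose: the
  topology of the type \<open>_ fps\<close> is the adic topology of its outermost variable (with discrete
  coefficients), and the infinite products and sums below converge \<open>q\<close>-adically, but not
  \<open>x\<close>-adically or \<open>y\<close>-adically.
\<close>

type_synonym 'a fps3 = "'a fps fps fps"

definition var_x :: "'a::comm_ring_1 fps3" where
  "var_x = fps_const (fps_const fps_X)"

definition var_y :: "'a::comm_ring_1 fps3" where
  "var_y = fps_const fps_X"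

definition var_q :: "'a::comm_ring_1 fps3" where
  "var_q = fps_X"

definition qpoch :: "'a::{t2_space, comm_ring_1} \<Rightarrow> 'a \<Rightarrow> enat \<Rightarrow> 'a" where
  "qpoch A q N =
     (case N of enat n \<Rightarrow> (\<Prod>k<n. 1 - A * q ^ k) | \<infinity> \<Rightarrow> (\<Prod>k. 1 - A * q ^ k))"

text \<open>
  The product defining \<open>(A; q\<^sup>d)\<^sub>\<infinity>\<close> converges whenever \<open>A\<close> is divisible by \<open>q\<close> and \<open>d \<ge> 1\<close>, so that
  the two infinite \<open>q\<close>-Pochhammer symbols used later are genuine limits of their partial products.
\<close>

lemma qpoch_convergent:
  fixes A :: "'a::field fps3"
  assumes A: "fps_nth A 0 = 0" and d: "d \<ge> 1"
  shows "convergent_prod (\<lambda>k. 1 - A * (var_q ^ d) ^ k)"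
proof -
  define P where "P = (\<lambda>n. \<Prod>k\<le>n. 1 - A * (var_q ^ d) ^ k)"
  have coeff_Suc: "fps_nth (P (Suc N)) n = fps_nth (P N) n" if "n \<le> N" for n N
  proof -
    have "P (Suc N) = P N - (P N * A) * var_q ^ (d * Suc N)"
      by (simp only: P_def prod.atMost_Suc power_mult) (simp add: algebra_simps)
    moreover have "n < d * Suc N"
      using that mult_le_mono1[OF d, of "Suc N"] by simp
    ultimately show ?thesis
      by (simp add: var_q_def fps_X_power_mult_right_nth del: mult_Suc_right)
  qed
  have const: "fps_nth (P N) n = fps_nth (P n) n" if "n \<le> N" for n N
    using that
  proof (induction N rule: dec_induct)
    case (step N)
    from step.IH show ?case
      by (simp only: coeff_Suc[OF step.hyps(1)])
  qed simp
  define L where "L = Abs_fps (\<lambda>n. fps_nth (P n) n)"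
  have "P \<longlonglongrightarrow> L"
    unfolding tendsto_fps_iff
  proof
    fix n
    show "\<forall>\<^sub>F N in sequentially. fps_nth (P N) n = fps_nth L n"
      by (rule eventually_sequentiallyI[of n]) (simp only: L_def fps_nth_Abs_fps, rule const)
  qed
  moreover have "fps_nth L 0 = 1"
    by (simp add: L_def P_def A)
  hence "L \<noteq> 0"
    by auto
  ultimately have "raw_has_prod (\<lambda>k. 1 - A * (var_q ^ d) ^ k) 0 L"
    by (simp add: raw_has_prod_def P_def)
  thus ?thesis
    by (auto simp: convergent_prod_def)
qed

text \<open>
  Division on \<open>K[[x]][[y]][[q]]\<close> is a total operation over a coefficient ring that is not a field.
  By divisors with constant term \<open>1\<close>, such as products of \<open>(q\<^sup>d; q\<^sup>d)\<^sub>n\<close>, it is genuine division.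
\<close>

lemma fps3_divide_mult:
  fixes f D :: "'a::field fps3"
  assumes "fps_nth D 0 = 1"
  shows "f / D * D = f"
proof -
  have i1: "inverse (1 :: 'a fps fps) = 1"
    by (rule fps_inverse_one') simp
  have "subdegree D = 0"
    using assms by (simp add: subdegree_eq_0_iff)
  hence "f / D = f * inverse D"
    by (simp add: fps_divide_def)
  moreover have "inverse D * D = 1"
    unfolding fps_inverse_def[of D] by (rule fps_left_inverse'[where x = 1]) (simp_all add: assms i1)
  ultimately show ?thesis
    by (simp add: mult.assoc)
qed

lemma qpoch_nth_0:
  assumes "d \<ge> 1"
  shows "fps_nth (qpoch (var_q ^ d) (var_q ^ d) (enat n) :: 'a::field fps3) 0 = 1"
  using assms by (induction n) (simp_all add: qpoch_def var_q_def fps_nth_power_0)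

end

theory Submission
  imports Defs
begin

text \<open>
  Put \<open>a = x q\<close>, \<open>b = x q\<^sup>3\<close>, \<open>c = y q\<^sup>2\<close>, \<open>Q = q\<^sup>4\<close>, so that the product side is
  \<open>(-a, -b, -c; Q)\<^sub>\<infinity>\<close>. The exponent of \<open>q\<close> contains \<open>4 (N choose 2)\<close> with \<open>N = n\<^sub>1 + n\<^sub>2 + n\<^sub>3 + n\<^sub>4\<close>,
  and by Euler's two expansions the sum side becomes \<open>S = \<Sum>\<^sub>N Q\<^bsup>N choose 2\<^esup> (1 + abc Q\<^bsup>2N\<^esup>) [z\<^sup>N] G(z)\<close>
  with \<open>G(z) = (-abz, -acz, -bcz; Q)\<^sub>\<infinity> / (az, bz, cz; Q)\<^sub>\<infinity>\<close>, which is symmetric in \<open>a, b, c\<close>.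
  The functional equation relating \<open>G(z)\<close> and \<open>G(Qz)\<close> gives \<open>S(a, b, c) = (1 + a) S(aQ, b, c)\<close>.
  In terms of \<open>x\<close> and \<open>y\<close> these are the shifts \<open>x \<mapsto> x q\<^sup>2\<close> (which sends \<open>(a, b)\<close> to \<open>(b, aQ)\<close>) and
  \<open>y \<mapsto> y q\<^sup>4\<close>; iterating them reduces everything to \<open>S = 1\<close> at \<open>x = y = 0\<close>.
\<close>

section \<open>Continuity of the ring operations in the adic topology\<close>

instance fps :: (ab_group_add) topological_comm_monoid_add
proof
  fix a b :: "'a fps"
  have *: "\<forall>\<^sub>F x in nhds a \<times>\<^sub>F nhds b. fps_nth (fst x) n = fps_nth a n \<and> fps_nth (snd x) n = fps_nth b n" for n
    using filterlim_fst[of "nhds a" "nhds b"] filterlim_snd[of "nhds b" "nhds a"]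
    by (simp add: tendsto_fps_iff eventually_conj_iff)
  show "filterlim (\<lambda>x. fst x + snd x) (nhds (a + b)) (nhds a \<times>\<^sub>F nhds b)"
    unfolding tendsto_fps_iff
  proof
    fix n
    show "\<forall>\<^sub>F x in nhds a \<times>\<^sub>F nhds b. fps_nth (fst x + snd x) n = fps_nth (a + b) n"
      using *[of n] by eventually_elim simp
  qed
qed

text \<open>Coefficient \<open>n\<close> of a product involves only the finitely many coefficients
  up to \<open>n\<close> of the factors, and near \<open>(a, b)\<close> those agree with the
  coefficients of \<open>a\<close> and \<open>b\<close>.\<close>

instance fps :: (ring) topological_semigroup_mult
proof
  fix a b :: "'a fps"
  have "\<forall>\<^sub>F x in nhds a \<times>\<^sub>F nhds b. fps_nth (fst x) n = fps_nth a n \<and> fps_nth (snd x) n = fps_nth b n" for n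
    using filterlim_fst[of "nhds a" "nhds b"] filterlim_snd[of "nhds b" "nhds a"]
    by (simp add: tendsto_fps_iff eventually_conj_iff)
  hence *: "\<forall>\<^sub>F x in nhds a \<times>\<^sub>F nhds b. \<forall>i\<in>{..n}. fps_nth (fst x) i = fps_nth a i \<and> fps_nth (snd x) i = fps_nth b i" for n
    by (intro eventually_ball_finite) auto
  show "filterlim (\<lambda>x. fst x * snd x) (nhds (a * b)) (nhds a \<times>\<^sub>F nhds b)"
    unfolding tendsto_fps_iff
  proof
    fix n
    show "\<forall>\<^sub>F x in nhds a \<times>\<^sub>F nhds b. fps_nth (fst x * snd x) n = fps_nth (a * b) n"
      using *[of n] by eventually_elim (auto simp: fps_mult_nth intro!: sum.cong)
  qed
qed

section \<open>Dilation and Euler's expansions\<close>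

definition fps_dilate :: "'a::comm_ring_1 \<Rightarrow> 'a fps \<Rightarrow> 'a fps" where
  "fps_dilate c F = Abs_fps (\<lambda>n. c ^ n * fps_nth F n)"

lemma fps_nth_dilate [simp]: "fps_nth (fps_dilate c F) n = c ^ n * fps_nth F n"
  by (simp add: fps_dilate_def)

lemma fps_dilate_mult: "fps_dilate c (F * G) = fps_dilate c F * fps_dilate c G"
proof (rule fps_ext)
  fix n
  have "c ^ n * (fps_nth F i * fps_nth G (n - i)) = c ^ i * fps_nth F i * (c ^ (n - i) * fps_nth G (n - i))"
    if "i \<le> n" for i
    using that power_add[of c i "n - i"] by (simp add: mult_ac)
  thus "fps_nth (fps_dilate c (F * G)) n = fps_nth (fps_dilate c F * fps_dilate c G) n"
    by (simp add: fps_mult_nth sum_distrib_left)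
qed

text \<open>
  For \<open>r n = 1 / (p; p)\<^sub>n\<close> these are the expansions in \<open>z\<close> of \<open>1 / (wz; p)\<^sub>\<infinity>\<close> and \<open>(-wz; p)\<^sub>\<infinity>\<close>.
\<close>

definition euler1 :: "(nat \<Rightarrow> 'a::comm_ring_1) \<Rightarrow> 'a \<Rightarrow> 'a fps" where
  "euler1 r w = Abs_fps (\<lambda>n. w ^ n * r n)"

definition euler2 :: "'a \<Rightarrow> (nat \<Rightarrow> 'a::comm_ring_1) \<Rightarrow> 'a \<Rightarrow> 'a fps" where
  "euler2 p r w = Abs_fps (\<lambda>n. p ^ (n choose 2) * w ^ n * r n)"

lemma choose_two_Suc: "Suc n choose 2 = n + (n choose 2)"
  by (simp add: numeral_2_eq_2)

lemma euler1_dilate: "fps_dilate p (euler1 r w) = euler1 r (w * p)"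
  by (rule fps_ext) (simp add: euler1_def power_mult_distrib mult_ac)

lemma euler2_dilate: "fps_dilate c (euler2 p r w) = euler2 p r (w * c)"
  by (rule fps_ext) (simp add: euler2_def power_mult_distrib mult_ac)

text \<open>For \<open>r n = 1 / (p; p)_n\<close> this splits the first factor 1 - wz off (wz;
  p)_infinity. The recurrence assumed for \<open>r\<close> is the comparison of
  coefficients.\<close>

lemma euler1_step:
  assumes "\<And>n. r n = r (Suc n) * (1 - p ^ Suc n)"
  shows "euler1 r (w * p) = (1 - fps_const w * fps_X) * euler1 r w"
proof (rule fps_ext)
  fix n
  show "fps_nth (euler1 r (w * p)) n = fps_nth ((1 - fps_const w * fps_X) * euler1 r w) n"
  proof (cases n)
    case (Suc m)
    show ?thesis
      by (simp add: Suc euler1_def left_diff_distrib mult.assoc power_mult_distrib assms[of m])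
         (simp add: algebra_simps)
  qed (simp add: euler1_def left_diff_distrib mult.assoc)
qed

text \<open>Now 1 + wz is split off (-wz; p)_infinity. The power \<open>p ^ m\<close> gained by
  \<open>Suc m choose 2\<close> matches the one contributed by the dilated series.\<close>

lemma euler2_step:
  assumes "\<And>n. r n = r (Suc n) * (1 - p ^ Suc n)"
  shows "euler2 p r w = (1 + fps_const w * fps_X) * euler2 p r (w * p)"
proof (rule fps_ext)
  fix n
  show "fps_nth (euler2 p r w) n = fps_nth ((1 + fps_const w * fps_X) * euler2 p r (w * p)) n"
  proof (cases n)
    case (Suc m)
    show ?thesis
      by (simp add: Suc euler2_def distrib_right mult.assoc power_mult_distrib assms[of m]
            choose_two_Suc power_add)
         (simp add: algebra_simps)
  qed (simp add: euler2_def distrib_right mult.assoc)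
qed

section \<open>Theta-weighted sums of the coefficients in z\<close>

lemma le_Suc_choose_two: "n \<le> Suc (n choose 2)"
  by (cases n) (simp_all add: choose_two_Suc)

text \<open>\<open>Q ^ m\<close> has no terms below degree \<open>m\<close>, and
  \<open>N choose 2\<close> is at least N - 1. So coefficient \<open>n\<close> sees only indices up
  to \<open>n + 1\<close>, whatever \<open>g\<close> is; the convergence of the sums rests on this
  cutoff.\<close>

lemma fps_power_choose_two_nth_eq_0:
  fixes Q :: "'a::comm_ring_1 fps"
  assumes "fps_nth Q 0 = 0" and "N > Suc n"
  shows "fps_nth (Q ^ ((N choose 2) + k * N) * g) n = 0"
proof -
  have "n < (N choose 2) + k * N"
    using le_Suc_choose_two[of N] assms(2) by simp
  hence "fps_nth (Q ^ ((N choose 2) + k * N)) i = 0" if "i \<le> n" for i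
    using startsby_zero_power_prefix[OF assms(1)] that by auto
  thus ?thesis
    by (simp add: fps_mult_nth)
qed

lemma summable_on_fpsI:
  assumes "\<And>n. finite {x\<in>A. fps_nth (F x) n \<noteq> 0}"
  shows "F summable_on A"
  unfolding summable_on_def
  by (rule exI[of _ "Abs_fps (\<lambda>n. \<Sum>x | x \<in> A \<and> fps_nth (F x) n \<noteq> 0. fps_nth (F x) n)"], rule has_sum_fpsI)
     (use assms in auto)

text \<open>A linear functional on series in z; \<open>k\<close> absorbs dilations by
  \<open>Q\<close> and factors z. The sum S of the overview is its value at G for
  \<open>k = 0\<close> plus abc times that for \<open>k = 2\<close>.\<close>

definition theta_sum :: "'a::comm_ring_1 fps \<Rightarrow> nat \<Rightarrow> 'a fps fps \<Rightarrow> 'a fps" where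
  "theta_sum Q k H = (\<Sum>\<^sub>\<infinity>N. Q ^ ((N choose 2) + k * N) * fps_nth H N)"

lemma has_sum_theta_sum:
  fixes Q :: "'a::comm_ring_1 fps"
  assumes "fps_nth Q 0 = 0"
  shows "((\<lambda>N. Q ^ ((N choose 2) + k * N) * fps_nth H N) has_sum theta_sum Q k H) UNIV"
  unfolding theta_sum_def
proof (rule has_sum_infsum, rule summable_on_fpsI)
  fix n
  have "{N \<in> UNIV. fps_nth (Q ^ ((N choose 2) + k * N) * fps_nth H N) n \<noteq> 0} \<subseteq> {..Suc n}"
    using fps_power_choose_two_nth_eq_0[OF assms] not_le by blast
  thus "finite {N \<in> UNIV. fps_nth (Q ^ ((N choose 2) + k * N) * fps_nth H N) n \<noteq> 0}"
    by (rule finite_subset) simp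
qed

lemma theta_sum_nth:
  fixes Q :: "'a::comm_ring_1 fps"
  assumes "fps_nth Q 0 = 0"
  shows "fps_nth (theta_sum Q k H) n
           = fps_nth (\<Sum>N\<le>Suc n. Q ^ ((N choose 2) + k * N) * fps_nth H N) n"
proof -
  let ?f = "\<lambda>N. Q ^ ((N choose 2) + k * N) * fps_nth H N"
  have "fps_nth (theta_sum Q k H) n = (\<Sum>N | N \<in> UNIV \<and> fps_nth (?f N) n \<noteq> 0. fps_nth (?f N) n)"
    by (rule has_sum_fpsD(2)[OF has_sum_theta_sum[OF assms]])
  also have "\<dots> = (\<Sum>N\<le>Suc n. fps_nth (?f N) n)"
    by (rule sum.mono_neutral_left)
       (use fps_power_choose_two_nth_eq_0[OF assms] not_le in blast)+
  finally show ?thesis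
    by (simp add: fps_sum_nth)
qed

text \<open>Coefficient \<open>n\<close> reads the same first \<open>n + 2\<close> coefficients of
  every \<open>H i\<close>, so convergence for each \<open>N\<close> separately suffices.\<close>

lemma tendsto_theta_sum:
  fixes Q :: "'a::comm_ring_1 fps"
  assumes Q: "fps_nth Q 0 = 0" and lim: "\<And>N. ((\<lambda>i. fps_nth (H i) N) \<longlongrightarrow> fps_nth L N) F"
  shows "((\<lambda>i. theta_sum Q k (H i)) \<longlongrightarrow> theta_sum Q k L) F"
  unfolding tendsto_fps_iff
proof
  fix n
  have "((\<lambda>i. \<Sum>N\<le>Suc n. Q ^ ((N choose 2) + k * N) * fps_nth (H i) N)
          \<longlongrightarrow> (\<Sum>N\<le>Suc n. Q ^ ((N choose 2) + k * N) * fps_nth L N)) F"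
    by (intro tendsto_sum tendsto_mult tendsto_const lim)
  thus "\<forall>\<^sub>F i in F. fps_nth (theta_sum Q k (H i)) n = fps_nth (theta_sum Q k L) n"
    unfolding theta_sum_nth[OF Q] tendsto_fps_iff by blast
qed

lemma theta_sum_add:
  assumes "fps_nth Q 0 = 0"
  shows "theta_sum Q k (F + G) = theta_sum Q k F + theta_sum Q k G"
  using infsumI[OF has_sum_add[OF has_sum_theta_sum[OF assms, of k F] has_sum_theta_sum[OF assms, of k G]]]
  by (simp add: theta_sum_def distrib_left)

lemma theta_sum_const_mult:
  assumes "fps_nth Q 0 = 0"
  shows "theta_sum Q k (fps_const c * F) = c * theta_sum Q k F"
  using infsumI[OF has_sum_cmult_right[OF has_sum_theta_sum[OF assms, of k F], of c]]
  by (simp add: theta_sum_def mult_ac)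

lemma theta_sum_dilate: "theta_sum Q k (fps_dilate Q F) = theta_sum Q (Suc k) F"
  by (simp add: theta_sum_def power_add mult_ac)

text \<open>Since \<open>Suc N choose 2 = N + (N choose 2)\<close>, shifting the index by one
  releases a factor \<open>Q ^ k\<close> and raises \<open>k\<close> by one.\<close>

lemma theta_sum_X_mult:
  fixes Q :: "'a::comm_ring_1 fps"
  assumes Q: "fps_nth Q 0 = 0"
  shows "theta_sum Q k (fps_X * F) = Q ^ k * theta_sum Q (Suc k) F"
proof -
  let ?f = "\<lambda>N. Q ^ ((N choose 2) + k * N) * fps_nth (fps_X * F) N"
  have "((\<lambda>N. Q ^ k * (Q ^ ((N choose 2) + Suc k * N) * fps_nth F N))
          has_sum Q ^ k * theta_sum Q (Suc k) F) UNIV"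
    by (intro has_sum_cmult_right has_sum_theta_sum Q)
  also have "(\<lambda>N. Q ^ k * (Q ^ ((N choose 2) + Suc k * N) * fps_nth F N)) = ?f \<circ> Suc"
    by (auto simp: choose_two_Suc power_add mult_ac)
  finally have "(?f has_sum Q ^ k * theta_sum Q (Suc k) F) (Suc ` UNIV)"
    by (subst has_sum_reindex) (auto simp only: inj_Suc)
  \<comment> \<open>\<open>fps_X * F\<close> has no constant term, so including the index 0 changes
    nothing.\<close>
  hence "(?f has_sum Q ^ k * theta_sum Q (Suc k) F) UNIV"
    by (rule has_sum_cong_neutral[THEN iffD1, rotated -1])
       (auto simp: image_iff gr0_conv_Suc)
  thus ?thesis
    unfolding theta_sum_def by (rule infsumI)
qed

text \<open>With \<open>theta_sum_dilate\<close>, this turns a functional equation with linear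
  factors into a linear relation between values at different \<open>k\<close>.\<close>

lemma theta_sum_linear_mult:
  assumes "fps_nth Q 0 = 0"
  shows "theta_sum Q k ((1 + fps_const s * fps_X) * F) = theta_sum Q k F + s * Q ^ k * theta_sum Q (Suc k) F"
    and "theta_sum Q k ((1 - fps_const s * fps_X) * F) = theta_sum Q k F - s * Q ^ k * theta_sum Q (Suc k) F"
proof -
  show *: "theta_sum Q k ((1 + fps_const s * fps_X) * F) = theta_sum Q k F + s * Q ^ k * theta_sum Q (Suc k) F" for s
    by (simp add: distrib_right theta_sum_add theta_sum_const_mult theta_sum_X_mult assms mult.assoc)
  show "theta_sum Q k ((1 - fps_const s * fps_X) * F) = theta_sum Q k F - s * Q ^ k * theta_sum Q (Suc k) F"
    using *[of "- s"] by (simp add: fps_const_neg[symmetric] del: fps_const_neg)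
qed

lemma theta_sum_one:
  fixes Q :: "'a::comm_ring_1 fps"
  shows "theta_sum Q k 1 = 1"
proof -
  have "((\<lambda>N. Q ^ ((N choose 2) + k * N) * fps_nth 1 N) has_sum 1) UNIV"
    by (rule has_sum_finite_neutralI[of "{0}"]) (auto simp: binomial_eq_0)
  thus ?thesis
    unfolding theta_sum_def by (rule infsumI)
qed

text \<open>
  Here \<open>H = G / ((1 + abz) (1 + acz))\<close>, and \<open>G'\<close> is \<open>G\<close> with \<open>aQ\<close> in place of \<open>a\<close>. Expressing both sides
  by the numbers \<open>theta_sum Q k H\<close>, their difference is \<open>-a\<close> times the image of the functional
  equation of \<open>H\<close> under \<open>theta_sum Q 0\<close>.
\<close>

lemma theta_sum_shift:
  fixes Q a b c :: "'a::comm_ring_1 fps"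
  assumes Q: "fps_nth Q 0 = 0"
    and H: "(1 - fps_const a * fps_X) * ((1 - fps_const b * fps_X) * ((1 - fps_const c * fps_X) * H))
          = (1 + fps_const (a * b * Q) * fps_X) * ((1 + fps_const (a * c * Q) * fps_X)
              * ((1 + fps_const (b * c) * fps_X) * fps_dilate Q H))"
    and G: "G = (1 + fps_const (a * b) * fps_X) * ((1 + fps_const (a * c) * fps_X) * H)"
    and G': "G' = (1 - fps_const a * fps_X) * H"
  shows "theta_sum Q 0 G + a * b * c * theta_sum Q 2 G
           = (1 + a) * (theta_sum Q 0 G' + a * b * c * Q * theta_sum Q 2 G')"
proof -
  let ?L = "\<lambda>k. theta_sum Q k H"
  note lin = theta_sum_linear_mult[OF Q] theta_sum_dilate eval_nat_numeral
  \<comment> \<open>A power z^j contributes \<open>Q ^ (j choose 2) * ?L j\<close> on the left; on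
    the right the dilation raises the index once more. At \<open>?L 2\<close> the terms in ab and ac
    cancel.\<close>
  have rel: "?L 0 = (1 + a + b + c) * ?L 1 + b * c * (1 - Q) * ?L 2
      + (a * b * Q * (a * c * Q) * Q + a * b * Q * (b * c) * Q + a * c * Q * (b * c) * Q + a * b * c * Q ^ 3) * ?L 3
      + a * b * Q * (a * c * Q) * (b * c) * Q ^ 3 * ?L 4"
    using arg_cong[OF H, of "theta_sum Q 0"]
    by (simp only: lin) (simp add: eval_nat_numeral algebra_simps)
  show ?thesis
    unfolding G G'
    by (simp only: lin) (use arg_cong[OF rel, of "\<lambda>u. a * u"] in \<open>simp add: eval_nat_numeral algebra_simps\<close>)
qed

section \<open>Expansion into a fourfold sum\<close>

lemma fps_mult4_nth:
  fixes F1 F2 F3 F4 :: "'a::comm_ring_1 fps"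
  shows "fps_nth (F1 * F2 * F3 * F4) N
    = (\<Sum>(n1, n2, n3, n4) | n1 + n2 + n3 + n4 = N.
         fps_nth F1 n1 * fps_nth F2 n2 * fps_nth F3 n3 * fps_nth F4 n4)"
proof -
  have "fps_nth (F1 * (F2 * (F3 * F4))) N
    = (\<Sum>(n1, n2, n3)\<in>(SIGMA n1:{0..N}. SIGMA n2:{0..N - n1}. {0..N - n1 - n2}).
        fps_nth F1 n1 * (fps_nth F2 n2 * (fps_nth F3 n3 * fps_nth F4 (N - n1 - n2 - n3))))"
    by (simp add: fps_mult_nth sum_distrib_left sum.Sigma case_prod_unfold)
  also have "\<dots> = (\<Sum>(n1, n2, n3, n4) | n1 + n2 + n3 + n4 = N.
         fps_nth F1 n1 * fps_nth F2 n2 * fps_nth F3 n3 * fps_nth F4 n4)"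
    by (rule sum.reindex_bij_witness[of _ "\<lambda>(n1, n2, n3, n4). (n1, n2, n3)"
          "\<lambda>(n1, n2, n3). (n1, n2, n3, N - n1 - n2 - n3)"]) (auto simp: mult_ac)
  finally show ?thesis
    by (simp add: mult.assoc)
qed

lemma finite_sum4_le: "finite {(n1, n2, n3, n4). n1 + n2 + n3 + n4 \<le> (N::nat)}"
  by (rule finite_subset[of _ "{..N} \<times> {..N} \<times> {..N} \<times> {..N}"]) auto

text \<open>Only the finitely many quadruples with total at most \<open>n + 1\<close> reach
  coefficient \<open>n\<close>, so the fourfold sum converges unconditionally. Grouping it by the
  total gives the coefficients of the product.\<close>

lemma has_sum_theta_sum_mult4:
  fixes Q :: "'a::comm_ring_1 fps"
  assumes Q: "fps_nth Q 0 = 0"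
  shows "((\<lambda>(n1, n2, n3, n4). Q ^ ((n1 + n2 + n3 + n4 choose 2) + k * (n1 + n2 + n3 + n4))
            * (fps_nth F1 n1 * fps_nth F2 n2 * fps_nth F3 n3 * fps_nth F4 n4))
          has_sum theta_sum Q k (F1 * F2 * F3 * F4)) UNIV"
proof -
  define w where "w N = Q ^ ((N choose 2) + k * N)" for N
  define t where "t = (\<lambda>(n1, n2, n3, n4). fps_nth F1 n1 * fps_nth F2 n2 * fps_nth F3 n3 * fps_nth F4 n4)"
  define s where "s = (\<lambda>(n1, n2, n3, n4). n1 + n2 + n3 + n4 :: nat)"
  define f where "f v = w (s v) * t v" for v
  define B where "B N = {v. s v = N}" for N
  have fin: "finite {v. s v \<le> N}" for N
    using finite_sum4_le[of N] by (simp add: s_def case_prod_unfold)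
  have finB: "finite (B N)" for N
    by (rule finite_subset[OF _ fin[of N]]) (auto simp: B_def)
  have "f summable_on UNIV"
  proof (rule summable_on_fpsI)
    fix n
    have "{v \<in> UNIV. fps_nth (f v) n \<noteq> 0} \<subseteq> {v. s v \<le> Suc n}"
    proof clarify
      fix v assume v: "fps_nth (f v) n \<noteq> 0"
      show "s v \<le> Suc n"
        using fps_power_choose_two_nth_eq_0[OF Q, of n "s v" k "t v"] v by (force simp: f_def w_def)
    qed
    thus "finite {v \<in> UNIV. fps_nth (f v) n \<noteq> 0}"
      by (rule finite_subset) (rule fin)
  qed
  hence f: "(f has_sum infsum f UNIV) UNIV"
    by (rule has_sum_infsum)
  also have "?this \<longleftrightarrow> ((\<lambda>(N, v). f v) has_sum infsum f UNIV) (SIGMA N:UNIV. B N)"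
    by (rule has_sum_reindex_bij_witness[of _ snd "\<lambda>v. (s v, v)"]) (auto simp: B_def)
  finally have "((\<lambda>N. \<Sum>v\<in>B N. f v) has_sum infsum f UNIV) UNIV"
    by (rule has_sum_SigmaD) (simp add: finB)
  also have "(\<lambda>N. \<Sum>v\<in>B N. f v) = (\<lambda>N. w N * fps_nth (F1 * F2 * F3 * F4) N)"
  proof
    fix N
    have "(\<Sum>v\<in>B N. f v) = (\<Sum>v\<in>B N. w N * t v)"
      by (rule sum.cong) (auto simp: f_def B_def)
    also have "\<dots> = w N * fps_nth (F1 * F2 * F3 * F4) N"
      by (simp add: sum_distrib_left fps_mult4_nth B_def s_def t_def case_prod_unfold)
    finally show "(\<Sum>v\<in>B N. f v) = w N * fps_nth (F1 * F2 * F3 * F4) N" .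
  qed
  finally have "infsum f UNIV = theta_sum Q k (F1 * F2 * F3 * F4)"
    using has_sum_theta_sum[OF Q, of k "F1 * F2 * F3 * F4"]
    by (auto simp: w_def dest: has_sum_unique)
  with f show ?thesis
    by (simp add: f_def[abs_def] w_def t_def s_def case_prod_unfold)
qed

section \<open>Reciprocal q-Pochhammer symbols and the quadruple series\<close>

definition rpoch :: "'a::field fps3 \<Rightarrow> nat \<Rightarrow> 'a fps3" where
  "rpoch p n = 1 / qpoch p p (enat n)"

lemma rpoch_qpoch:
  assumes "d \<ge> 1"
  shows "rpoch (var_q ^ d) n * qpoch (var_q ^ d) (var_q ^ d) (enat n) = (1 :: 'a::field fps3)"
  unfolding rpoch_def by (rule fps3_divide_mult[OF qpoch_nth_0[OF assms]])

lemma rpoch_0: "rpoch (var_q ^ d) 0 = (1 :: 'a::field fps3)"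
  using fps3_divide_mult[of 1 1] by (simp add: rpoch_def qpoch_def)

text \<open>This is the hypothesis of \<open>euler1_step\<close> and \<open>euler2_step\<close>.
  Both sides become 1 when multiplied by (p; p)_n, which cancels in an integral domain.\<close>

lemma rpoch_Suc:
  fixes p :: "'a::field fps3"
  assumes "d \<ge> 1" and p: "p = var_q ^ d"
  shows "rpoch p n = rpoch p (Suc n) * (1 - p ^ Suc n)"
proof -
  define D where "D = qpoch p p (enat n)"
  have D: "qpoch p p (enat (Suc n)) = D * (1 - p ^ Suc n)"
    by (simp add: D_def qpoch_def)
  have "rpoch p n * D = 1" "rpoch p (Suc n) * (D * (1 - p ^ Suc n)) = 1"
    unfolding D[symmetric] by (simp_all only: D_def p rpoch_qpoch[OF assms(1)])
  hence "rpoch p n * D = rpoch p (Suc n) * (1 - p ^ Suc n) * D" and "D \<noteq> 0"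
    by (auto simp only: mult_ac mult_zero_left zero_neq_one)
  thus ?thesis
    using mult_right_cancel by blast
qed

text \<open>
  The series \<open>G(z)\<close> in factored form: the factors with base \<open>q\<^sup>2\<close> merge those of \<open>a\<close> and \<open>b\<close>,
  respectively \<open>ac\<close> and \<open>bc\<close>.
\<close>

definition quad_series :: "'a::field fps3 \<Rightarrow> 'a fps3 \<Rightarrow> 'a fps3 fps" where
  "quad_series X Y = euler1 (rpoch (var_q ^ 2)) (X * var_q)
     * euler2 (var_q ^ 2) (rpoch (var_q ^ 2)) (X * Y * var_q ^ 3)
     * euler1 (rpoch (var_q ^ 4)) (Y * var_q ^ 2)
     * euler2 (var_q ^ 4) (rpoch (var_q ^ 4)) (X ^ 2 * var_q ^ 4)"

text \<open>Here abc = X^2 Y q^6, and the index 2 supplies Q^(2N) = q^(8N). \<open>X\<close> and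
  \<open>Y\<close> are arbitrary series so that the shifts can be iterated.\<close>

definition quad_sum :: "'a::field fps3 \<Rightarrow> 'a fps3 \<Rightarrow> 'a fps3" where
  "quad_sum X Y = theta_sum (var_q ^ 4) 0 (quad_series X Y)
     + X ^ 2 * Y * var_q ^ 6 * theta_sum (var_q ^ 4) 2 (quad_series X Y)"

section \<open>The two shift equations\<close>

lemma var_q_power_nth_0: "d \<ge> 1 \<Longrightarrow> fps_nth (var_q ^ d :: 'a::field fps3) 0 = 0"
  by (simp add: var_q_def)

text \<open>Dilation by q^4 amounts to two Euler steps in base q^2 and to one in base q^4.\<close>

lemma euler1_dilate4:
  fixes w :: "'a::field fps3"
  defines "q \<equiv> var_q"
  shows "fps_dilate (q ^ 4) (euler1 (rpoch (q ^ 2)) w)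
           = (1 - fps_const (w * q ^ 2) * fps_X) * ((1 - fps_const w * fps_X) * euler1 (rpoch (q ^ 2)) w)"
    and "fps_dilate (q ^ 4) (euler1 (rpoch (q ^ 4)) w)
           = (1 - fps_const w * fps_X) * euler1 (rpoch (q ^ 4)) w"
proof -
  have "w * q ^ 4 = w * q ^ 2 * q ^ 2"
    by (simp add: power_add[symmetric] mult.assoc)
  thus "fps_dilate (q ^ 4) (euler1 (rpoch (q ^ 2)) w)
           = (1 - fps_const (w * q ^ 2) * fps_X) * ((1 - fps_const w * fps_X) * euler1 (rpoch (q ^ 2)) w)"
    by (simp only: euler1_dilate euler1_step[OF rpoch_Suc[of 2]] q_def one_le_numeral)
  show "fps_dilate (q ^ 4) (euler1 (rpoch (q ^ 4)) w)
           = (1 - fps_const w * fps_X) * euler1 (rpoch (q ^ 4)) w"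
    by (simp only: euler1_dilate euler1_step[OF rpoch_Suc[of 4]] q_def one_le_numeral)
qed

text \<open>\<open>u\<close> and \<open>v\<close> are kept apart from \<open>w\<close> so that they
  can be supplied as products of a, b, c and Q.\<close>

lemma euler2_dilate4:
  fixes u v w :: "'a::field fps3"
  defines "q \<equiv> var_q"
  assumes u: "u = w"
  shows "v = w * q ^ 2 \<Longrightarrow> euler2 (q ^ 2) (rpoch (q ^ 2)) w = (1 + fps_const u * fps_X)
           * ((1 + fps_const v * fps_X) * fps_dilate (q ^ 4) (euler2 (q ^ 2) (rpoch (q ^ 2)) w))"
    and "euler2 (q ^ 4) (rpoch (q ^ 4)) w = (1 + fps_const u * fps_X)
           * fps_dilate (q ^ 4) (euler2 (q ^ 4) (rpoch (q ^ 4)) w)"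
proof -
  have 4: "w * q ^ 4 = w * q ^ 2 * q ^ 2"
    by (simp add: power_add[symmetric] mult.assoc)
  show "euler2 (q ^ 2) (rpoch (q ^ 2)) w = (1 + fps_const u * fps_X)
           * ((1 + fps_const v * fps_X) * fps_dilate (q ^ 4) (euler2 (q ^ 2) (rpoch (q ^ 2)) w))"
    if "v = w * q ^ 2"
    unfolding euler2_dilate 4 u that unfolding q_def
    by (subst euler2_step[OF rpoch_Suc[of 2]], simp, simp)
       (subst euler2_step[OF rpoch_Suc[of 2]], simp_all only: one_le_numeral)
  show "euler2 (q ^ 4) (rpoch (q ^ 4)) w = (1 + fps_const u * fps_X)
           * fps_dilate (q ^ 4) (euler2 (q ^ 4) (rpoch (q ^ 4)) w)"
    unfolding euler2_dilate u q_def
    by (rule euler2_step[OF rpoch_Suc[of 4]]) simp_all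
qed

text \<open>The shift replaces (a, b) by (b, aQ). By symmetry in a and b this amounts to shifting a
  alone, so \<open>theta_sum_shift\<close> applies.\<close>

lemma quad_sum_shift_x:
  fixes X Y :: "'a::field fps3"
  shows "quad_sum X Y = (1 + X * var_q) * quad_sum (X * var_q ^ 2) Y"
proof -
  define q :: "'a fps3" where "q = var_q"
  define a b c Q where "a = X * q" and "b = X * q ^ 3" and "c = Y * q ^ 2" and "Q = q ^ 4"
  note defs = a_def b_def c_def Q_def eval_nat_numeral mult_ac
  let ?I2 = "euler1 (rpoch (q ^ 2)) (X * q)"
  \<comment> \<open>H is G without 1 + acz and 1 + abz, where ac = X Y q^3 and ab = X^2 q^4. So
    \<open>?E2\<close> starts one factor later at bc = X Y q^5, and \<open>?E4\<close> at abQ = X^2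
    q^8.\<close>
  let ?E2 = "euler2 (q ^ 2) (rpoch (q ^ 2)) (X * Y * q ^ 5)"
  let ?I4 = "euler1 (rpoch (q ^ 4)) (Y * q ^ 2)"
  let ?E4 = "euler2 (q ^ 4) (rpoch (q ^ 4)) (X ^ 2 * q ^ 8)"
  let ?lin = "\<lambda>s::'a fps3. 1 + fps_const s * fps_X" and ?lin' = "\<lambda>s::'a fps3. 1 - fps_const s * fps_X"
  have I2: "?lin' b * (?lin' a * ?I2) = fps_dilate Q ?I2"
    using euler1_dilate4(1)[of "X * q", folded q_def] by (simp add: defs)
  have I4: "?lin' c * ?I4 = fps_dilate Q ?I4"
    using euler1_dilate4(2)[of "Y * q ^ 2", folded q_def] by (simp add: defs)
  have E2: "?E2 = ?lin (b * c) * (?lin (a * c * Q) * fps_dilate Q ?E2)"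
    unfolding Q_def unfolding q_def by (rule euler2_dilate4(1)) (simp_all add: defs q_def)
  have E4: "?E4 = ?lin (a * b * Q) * fps_dilate Q ?E4"
    unfolding Q_def unfolding q_def by (rule euler2_dilate4(2)) (simp add: defs q_def)
  have "?lin' a * (?lin' b * (?lin' c * (?I2 * ?E2 * ?I4 * ?E4)))
      = (?lin' b * (?lin' a * ?I2)) * ?E2 * (?lin' c * ?I4) * ?E4"
    by (simp only: mult_ac)
  also have "\<dots> = fps_dilate Q ?I2 * (?lin (b * c) * (?lin (a * c * Q) * fps_dilate Q ?E2))
      * fps_dilate Q ?I4 * (?lin (a * b * Q) * fps_dilate Q ?E4)"
    by (intro arg_cong2[where f = "(*)"] I2 I4 E2 E4)
  also have "\<dots> = ?lin (a * b * Q) * (?lin (a * c * Q)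
      * (?lin (b * c) * fps_dilate Q (?I2 * ?E2 * ?I4 * ?E4)))"
    by (simp only: fps_dilate_mult mult_ac)
  finally have H: "?lin' a * (?lin' b * (?lin' c * (?I2 * ?E2 * ?I4 * ?E4))) = \<dots>" .
  have "euler2 (q ^ 2) (rpoch (q ^ 2)) (X * Y * q ^ 3) = ?lin (a * c) * ?E2"
    using euler2_step[OF rpoch_Suc[of 2], of "q ^ 2" "X * Y * q ^ 3"] by (simp add: defs q_def)
  moreover have "euler2 (q ^ 4) (rpoch (q ^ 4)) (X ^ 2 * q ^ 4) = ?lin (a * b) * ?E4"
    using euler2_step[OF rpoch_Suc[of 4], of "q ^ 4" "X ^ 2 * q ^ 4"] by (simp add: defs q_def)
  ultimately have G: "quad_series X Y = ?lin (a * b) * (?lin (a * c) * (?I2 * ?E2 * ?I4 * ?E4))"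
    unfolding quad_series_def q_def[symmetric] by (simp only: mult_ac)
  have "euler1 (rpoch (q ^ 2)) (X * q ^ 2 * q) = ?lin' a * ?I2"
    using euler1_step[OF rpoch_Suc[of 2], of "q ^ 2" "X * q"] by (simp add: defs q_def)
  moreover have "X * q ^ 2 * Y * q ^ 3 = X * Y * q ^ 5" "(X * q ^ 2) ^ 2 * q ^ 4 = X ^ 2 * q ^ 8"
    by (simp_all add: defs)
  ultimately have G': "quad_series (X * q ^ 2) Y = ?lin' a * (?I2 * ?E2 * ?I4 * ?E4)"
    unfolding quad_series_def q_def[symmetric] by (simp only: mult_ac)
  have "fps_nth Q 0 = 0"
    by (simp add: Q_def q_def var_q_power_nth_0)
  from theta_sum_shift[OF this H G G'] show ?thesis
    unfolding quad_sum_def q_def[symmetric] by (simp add: defs)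
qed

text \<open>The name \<open>a\<close> passes to \<open>Y * q ^ 2\<close>, the parameter that moves;
  the two parameters from \<open>X\<close> become \<open>b\<close> and \<open>c\<close>.\<close>

lemma quad_sum_shift_y:
  fixes X Y :: "'a::field fps3"
  shows "quad_sum X Y = (1 + Y * var_q ^ 2) * quad_sum X (Y * var_q ^ 4)"
proof -
  define q :: "'a fps3" where "q = var_q"
  define a b c Q where "a = Y * q ^ 2" and "b = X * q" and "c = X * q ^ 3" and "Q = q ^ 4"
  note defs = a_def b_def c_def Q_def eval_nat_numeral mult_ac
  let ?I2 = "euler1 (rpoch (q ^ 2)) (X * q)"
  \<comment> \<open>Both ab = X Y q^3 and ac = X Y q^5 belong to this base q^2 product, so it loses
    two factors and starts at exponent 7; \<open>?E4\<close>, which belongs to bc, stays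
    intact.\<close>
  let ?E2 = "euler2 (q ^ 2) (rpoch (q ^ 2)) (X * Y * q ^ 7)"
  let ?I4 = "euler1 (rpoch (q ^ 4)) (Y * q ^ 2)"
  let ?E4 = "euler2 (q ^ 4) (rpoch (q ^ 4)) (X ^ 2 * q ^ 4)"
  let ?lin = "\<lambda>s::'a fps3. 1 + fps_const s * fps_X" and ?lin' = "\<lambda>s::'a fps3. 1 - fps_const s * fps_X"
  have I2: "?lin' c * (?lin' b * ?I2) = fps_dilate Q ?I2"
    using euler1_dilate4(1)[of "X * q", folded q_def] by (simp add: defs)
  have I4: "?lin' a * ?I4 = fps_dilate Q ?I4"
    using euler1_dilate4(2)[of "Y * q ^ 2", folded q_def] by (simp add: defs)
  have E2: "?E2 = ?lin (a * b * Q) * (?lin (a * c * Q) * fps_dilate Q ?E2)"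
    unfolding Q_def unfolding q_def by (rule euler2_dilate4(1)) (simp_all add: defs q_def)
  have E4: "?E4 = ?lin (b * c) * fps_dilate Q ?E4"
    unfolding Q_def unfolding q_def by (rule euler2_dilate4(2)) (simp add: defs q_def)
  have "?lin' a * (?lin' b * (?lin' c * (?I2 * ?E2 * ?I4 * ?E4)))
      = (?lin' c * (?lin' b * ?I2)) * ?E2 * (?lin' a * ?I4) * ?E4"
    by (simp only: mult_ac)
  also have "\<dots> = fps_dilate Q ?I2 * (?lin (a * b * Q) * (?lin (a * c * Q) * fps_dilate Q ?E2))
      * fps_dilate Q ?I4 * (?lin (b * c) * fps_dilate Q ?E4)"
    by (intro arg_cong2[where f = "(*)"] I2 I4 E2 E4)
  also have "\<dots> = ?lin (a * b * Q) * (?lin (a * c * Q)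
      * (?lin (b * c) * fps_dilate Q (?I2 * ?E2 * ?I4 * ?E4)))"
    by (simp only: fps_dilate_mult mult_ac)
  finally have H: "?lin' a * (?lin' b * (?lin' c * (?I2 * ?E2 * ?I4 * ?E4))) = \<dots>" .
  have "euler2 (q ^ 2) (rpoch (q ^ 2)) (X * Y * q ^ 3) = ?lin (a * b) * (?lin (a * c) * ?E2)"
    using euler2_dilate4(1)[OF refl refl, of "X * Y * q ^ 3", folded q_def] by (simp add: defs euler2_dilate)
  hence G: "quad_series X Y = ?lin (a * b) * (?lin (a * c) * (?I2 * ?E2 * ?I4 * ?E4))"
    unfolding quad_series_def q_def[symmetric] by (simp only: mult_ac)
  have "euler1 (rpoch (q ^ 4)) (Y * q ^ 4 * q ^ 2) = ?lin' a * ?I4"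
    using euler1_step[OF rpoch_Suc[of 4], of "q ^ 4" "Y * q ^ 2"] by (simp add: defs q_def)
  moreover have "X * (Y * q ^ 4) * q ^ 3 = X * Y * q ^ 7"
    by (simp_all add: defs)
  ultimately have G': "quad_series X (Y * q ^ 4) = ?lin' a * (?I2 * ?E2 * ?I4 * ?E4)"
    unfolding quad_series_def q_def[symmetric] by (simp only: mult_ac)
  have "fps_nth Q 0 = 0"
    by (simp add: Q_def q_def var_q_power_nth_0)
  from theta_sum_shift[OF this H G G'] show ?thesis
    unfolding quad_sum_def q_def[symmetric] by (simp add: defs)
qed

section \<open>Iterating the shifts to the limit\<close>

lemma tendsto_fps_power:
  fixes f :: "'b \<Rightarrow> 'a::comm_ring_1 fps"
  assumes "(f \<longlongrightarrow> l) F"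
  shows "((\<lambda>i. f i ^ n) \<longlongrightarrow> l ^ n) F"
  by (induction n) (auto intro!: tendsto_mult assms)

text \<open>Each coefficient in z of \<open>quad_series\<close> is a polynomial in \<open>X\<close>
  and \<open>Y\<close>, hence continuous; \<open>tendsto_theta_sum\<close> carries this over to the
  sums.\<close>

lemma tendsto_quad_sum:
  fixes X Y :: "'a::field fps3"
  assumes "(f \<longlongrightarrow> X) F" "(g \<longlongrightarrow> Y) F"
  shows "((\<lambda>i. quad_sum (f i) (g i)) \<longlongrightarrow> quad_sum X Y) F"
proof -
  have "((\<lambda>i. fps_nth (quad_series (f i) (g i)) N) \<longlongrightarrow> fps_nth (quad_series X Y) N) F" for N
    unfolding quad_series_def fps_mult_nth euler1_def euler2_def fps_nth_Abs_fps
    by (intro tendsto_sum tendsto_mult tendsto_const tendsto_fps_power assms)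
  thus ?thesis
    unfolding quad_sum_def
    by (intro tendsto_add tendsto_mult tendsto_const tendsto_fps_power tendsto_theta_sum assms)
       (simp_all add: var_q_power_nth_0)
qed

lemma tendsto_mult_var_q_power:
  fixes X :: "'a::field fps3"
  assumes "d \<ge> 1"
  shows "(\<lambda>n. X * (var_q ^ d) ^ n) \<longlonglongrightarrow> 0"
  unfolding tendsto_fps_iff
proof
  fix m
  show "\<forall>\<^sub>F n in sequentially. fps_nth (X * (var_q ^ d) ^ n) m = fps_nth 0 m"
  proof (rule eventually_sequentiallyI[of "Suc m"])
    fix n assume "n \<ge> Suc m"
    hence "m < d * n"
      using mult_le_mono1[OF assms, of n] by linarith
    thus "fps_nth (X * (var_q ^ d) ^ n) m = fps_nth 0 m"
      by (simp add: var_q_def power_mult[symmetric] fps_X_power_mult_right_nth)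
  qed
qed

text \<open>Unrolling the recurrence writes the constant \<open>f 0\<close> as a partial product
  times \<open>f (Suc n)\<close>; then n tends to infinity.\<close>

lemma qpoch_infinity_unique:
  fixes A :: "'a::field fps3"
  assumes A: "fps_nth A 0 = 0" and d: "d \<ge> 1"
    and step: "\<And>n. f n = (1 - A * (var_q ^ d) ^ n) * f (Suc n)" and lim: "f \<longlonglongrightarrow> l"
  shows "f 0 = qpoch A (var_q ^ d) \<infinity> * l"
proof -
  have eq: "f 0 = (\<Prod>k\<le>n. 1 - A * (var_q ^ d) ^ k) * f (Suc n)" for n
  proof (induction n)
    case (Suc n)
    show ?case
      by (subst Suc, subst step[of "Suc n"]) (simp add: mult_ac)
  qed (use step[of 0] in simp)
  have "(\<lambda>n. \<Prod>k\<le>n. 1 - A * (var_q ^ d) ^ k) \<longlonglongrightarrow> qpoch A (var_q ^ d) \<infinity>"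
  proof -
    \<comment> \<open>Convergence in the sense of \<open>convergent_prod\<close> tolerates zero
      factors. Constant term 1 excludes them, so the product is the limit of the partial products
      from index 0 on.\<close>
    have "fps_nth (1 - A * (var_q ^ d) ^ k) 0 = 1" for k
      by (simp add: A)
    hence "1 - A * (var_q ^ d) ^ k \<noteq> 0" for k
      by (metis fps_zero_nth zero_neq_one)
    from convergent_prod_offset_0[OF qpoch_convergent[OF A d] this]
    obtain p where p: "(\<lambda>k. 1 - A * (var_q ^ d) ^ k) has_prod p"
      by (auto simp: has_prod_def)
    show ?thesis
      using has_prod_imp_tendsto[OF p] has_prod_unique[OF p] by (simp add: qpoch_def)
  qed
  hence "(\<lambda>n. (\<Prod>k\<le>n. 1 - A * (var_q ^ d) ^ k) * f (Suc n)) \<longlonglongrightarrow> qpoch A (var_q ^ d) \<infinity> * l"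
    by (intro tendsto_mult LIMSEQ_Suc lim)
  thus ?thesis
    unfolding eq[symmetric] by (simp add: LIMSEQ_const_iff)
qed

lemma quad_sum_0_0: "quad_sum 0 0 = (1 :: 'a::field fps3)"
proof -
  have "euler1 (rpoch (var_q ^ d)) 0 = (1 :: 'a fps3 fps)"
    and "euler2 p (rpoch (var_q ^ d)) 0 = (1 :: 'a fps3 fps)" for d p
    by (auto intro!: fps_ext simp: euler1_def euler2_def power_0_left rpoch_0 binomial_eq_0)
  thus ?thesis
    by (simp add: quad_sum_def quad_series_def theta_sum_one)
qed

text \<open>First \<open>X\<close> is driven to 0 with \<open>Y\<close> fixed, then \<open>Y\<close>
  with \<open>X = 0\<close>; each limit contributes one infinite product, and
  \<open>quad_sum 0 0 = 1\<close> remains.\<close>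

lemma quad_sum_eq_qpoch:
  fixes X Y :: "'a::field fps3"
  shows "quad_sum X Y = qpoch (- X * var_q) (var_q ^ 2) \<infinity> * qpoch (- Y * var_q ^ 2) (var_q ^ 4) \<infinity>"
proof -
  define q :: "'a fps3" where "q = var_q"
  have "quad_sum (X * (q ^ 2) ^ 0) Y = qpoch (- X * q) (q ^ 2) \<infinity> * quad_sum 0 Y"
    unfolding q_def
  proof (rule qpoch_infinity_unique)
    show "quad_sum (X * (var_q ^ 2) ^ n) Y
        = (1 - - X * var_q * (var_q ^ 2) ^ n) * quad_sum (X * (var_q ^ 2) ^ Suc n) Y" for n
      using quad_sum_shift_x[of "X * (var_q ^ 2) ^ n" Y] by (simp add: mult_ac)
    show "(\<lambda>n. quad_sum (X * (var_q ^ 2) ^ n) Y) \<longlonglongrightarrow> quad_sum 0 Y"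
      by (intro tendsto_quad_sum tendsto_mult_var_q_power tendsto_const) simp
  qed (simp_all add: var_q_def)
  moreover have "quad_sum 0 (Y * (q ^ 4) ^ 0) = qpoch (- Y * q ^ 2) (q ^ 4) \<infinity> * quad_sum 0 0"
    unfolding q_def
  proof (rule qpoch_infinity_unique)
    show "quad_sum 0 (Y * (var_q ^ 4) ^ n)
        = (1 - - Y * var_q ^ 2 * (var_q ^ 4) ^ n) * quad_sum 0 (Y * (var_q ^ 4) ^ Suc n)" for n
      using quad_sum_shift_y[of 0 "Y * (var_q ^ 4) ^ n"] by (simp add: mult_ac)
    show "(\<lambda>n. quad_sum 0 (Y * (var_q ^ 4) ^ n)) \<longlonglongrightarrow> quad_sum 0 0"
      by (intro tendsto_quad_sum tendsto_mult_var_q_power tendsto_const) simp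
  qed (simp_all add: var_q_def)
  ultimately show ?thesis
    by (simp add: quad_sum_0_0 q_def)
qed

section \<open>Matching the summands\<close>

lemma fps3_divide_rpoch:
  fixes f :: "'a::field fps3"
  defines "q \<equiv> var_q"
  shows "f / (qpoch (q ^ 2) (q ^ 2) (enat n1) * qpoch (q ^ 2) (q ^ 2) (enat n2)
            * qpoch (q ^ 4) (q ^ 4) (enat n3) * qpoch (q ^ 4) (q ^ 4) (enat n4))
       = f * rpoch (q ^ 2) n1 * rpoch (q ^ 2) n2 * rpoch (q ^ 4) n3 * rpoch (q ^ 4) n4"
proof -
  define D1 D2 D3 D4 where "D1 = qpoch (q ^ 2) (q ^ 2) (enat n1)" and "D2 = qpoch (q ^ 2) (q ^ 2) (enat n2)"
    and "D3 = qpoch (q ^ 4) (q ^ 4) (enat n3)" and "D4 = qpoch (q ^ 4) (q ^ 4) (enat n4)"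
  have D0: "fps_nth (D1 * D2 * D3 * D4) 0 = 1"
    by (simp add: D1_def D2_def D3_def D4_def q_def qpoch_nth_0)
  have inv: "rpoch (q ^ 2) n1 * D1 = 1" "rpoch (q ^ 2) n2 * D2 = 1"
    "rpoch (q ^ 4) n3 * D3 = 1" "rpoch (q ^ 4) n4 * D4 = 1"
    by (simp_all add: D1_def D2_def D3_def D4_def q_def rpoch_qpoch)
  have "f * rpoch (q ^ 2) n1 * rpoch (q ^ 2) n2 * rpoch (q ^ 4) n3 * rpoch (q ^ 4) n4 * (D1 * D2 * D3 * D4)
      = f * (rpoch (q ^ 2) n1 * D1) * (rpoch (q ^ 2) n2 * D2)
          * (rpoch (q ^ 4) n3 * D3) * (rpoch (q ^ 4) n4 * D4)"
    by (simp only: mult_ac)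
  also have "\<dots> = f / (D1 * D2 * D3 * D4) * (D1 * D2 * D3 * D4)"
    by (simp only: inv fps3_divide_mult[OF D0] mult_1_right)
  finally have "f * rpoch (q ^ 2) n1 * rpoch (q ^ 2) n2 * rpoch (q ^ 4) n3 * rpoch (q ^ 4) n4
      = f / (D1 * D2 * D3 * D4)"
    using D0 by (subst (asm) mult_right_cancel) auto
  thus ?thesis
    by (simp add: D1_def D2_def D3_def D4_def)
qed

text \<open>Iterated, this produces the cross terms 4 n_i n_j of the exponent from four times
  \<open>n1 + n2 + n3 + n4 choose 2\<close>.\<close>

lemma choose_two_add: "(m + n choose 2) = (m choose 2) + (n choose 2) + m * n"
  by (induction m) (simp_all add: choose_two_Suc binomial_eq_0)

theorem theorem1p1:
  fixes x y q :: "'a::field fps3"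
  defines "x \<equiv> var_x" and "y \<equiv> var_y" and "q \<equiv> var_q"
  shows
    "((\<lambda>(n1, n2, n3, n4).
         x ^ (n1 + n2 + 2 * n4) * y ^ (n2 + n3) * q ^ (n1 + 3 * n2 + 2 * n3 + 4 * n4)
           * (1 + x ^ 2 * y * q ^ (6 + 8 * (n1 + n2 + n3 + n4)))
         / (qpoch (q ^ 2) (q ^ 2) (enat n1) * qpoch (q ^ 2) (q ^ 2) (enat n2)
            * qpoch (q ^ 4) (q ^ 4) (enat n3) * qpoch (q ^ 4) (q ^ 4) (enat n4))
         * q ^ (4 * (n1 choose 2) + 6 * (n2 choose 2) + 4 * (n3 choose 2) + 8 * (n4 choose 2)
                + 4 * n1 * n2 + 4 * n1 * n3 + 4 * n1 * n4
                + 4 * n2 * n3 + 4 * n2 * n4 + 4 * n3 * n4))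
      has_sum (qpoch (- x * q) (q ^ 2) \<infinity> * qpoch (- y * q ^ 2) (q ^ 4) \<infinity>))
      (UNIV :: (nat \<times> nat \<times> nat \<times> nat) set)"
proof -
  define F where "F = (\<lambda>(n1, n2, n3, n4).
     fps_nth (euler1 (rpoch (q ^ 2)) (x * q)) n1
     * fps_nth (euler2 (q ^ 2) (rpoch (q ^ 2)) (x * y * q ^ 3)) n2
     * fps_nth (euler1 (rpoch (q ^ 4)) (y * q ^ 2)) n3
     * fps_nth (euler2 (q ^ 4) (rpoch (q ^ 4)) (x ^ 2 * q ^ 4)) n4)"
  \<comment> \<open>The weights for \<open>k = 0\<close> and \<open>k = 2\<close> belong to the two
    terms of the factor 1 + x^2 y q^(6 + 8N), with N the total.\<close>
  define w where "w k = (\<lambda>(n1, n2, n3, n4).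
     (q ^ 4) ^ ((n1 + n2 + n3 + n4 choose 2) + k * (n1 + n2 + n3 + n4)))" for k :: nat
  have Q: "fps_nth (q ^ 4) 0 = 0"
    by (simp add: q_def var_q_power_nth_0)
  have *: "((\<lambda>v. w k v * F v) has_sum theta_sum (q ^ 4) k (quad_series x y)) UNIV" for k
    using has_sum_theta_sum_mult4[OF Q, of k]
    unfolding quad_series_def F_def w_def q_def[symmetric] by (simp add: case_prod_unfold)
  have "((\<lambda>v. w 0 v * F v + x ^ 2 * y * q ^ 6 * (w 2 v * F v)) has_sum quad_sum x y) UNIV"
    unfolding quad_sum_def q_def[symmetric] by (intro has_sum_add has_sum_cmult_right *)
  also have "(\<lambda>v. w 0 v * F v + x ^ 2 * y * q ^ 6 * (w 2 v * F v)) = (\<lambda>(n1, n2, n3, n4).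
         x ^ (n1 + n2 + 2 * n4) * y ^ (n2 + n3) * q ^ (n1 + 3 * n2 + 2 * n3 + 4 * n4)
           * (1 + x ^ 2 * y * q ^ (6 + 8 * (n1 + n2 + n3 + n4)))
         / (qpoch (q ^ 2) (q ^ 2) (enat n1) * qpoch (q ^ 2) (q ^ 2) (enat n2)
            * qpoch (q ^ 4) (q ^ 4) (enat n3) * qpoch (q ^ 4) (q ^ 4) (enat n4))
         * q ^ (4 * (n1 choose 2) + 6 * (n2 choose 2) + 4 * (n3 choose 2) + 8 * (n4 choose 2)
                + 4 * n1 * n2 + 4 * n1 * n3 + 4 * n1 * n4
                + 4 * n2 * n3 + 4 * n2 * n4 + 4 * n3 * n4))"
  proof (rule ext, clarify)
    fix n1 n2 n3 n4
    define r where "r = rpoch (q ^ 2) n1 * rpoch (q ^ 2) n2 * rpoch (q ^ 4) n3 * rpoch (q ^ 4) n4"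
    define e where "e = 4 * (n1 choose 2) + 6 * (n2 choose 2) + 4 * (n3 choose 2) + 8 * (n4 choose 2)
                + 4 * n1 * n2 + 4 * n1 * n3 + 4 * n1 * n4
                + 4 * n2 * n3 + 4 * n2 * n4 + 4 * n3 * n4"
    define l where "l = n1 + 3 * n2 + 2 * n3 + 4 * n4"
    \<comment> \<open>The surplus over 4 (N choose 2): it comes from the powers
      \<open>p ^ (n choose 2)\<close> in the two \<open>euler2\<close> factors, with p = q^2 for
      \<open>n2\<close> and p = q^4 for \<open>n4\<close>.\<close>
    define c where "c = 2 * (n2 choose 2) + 4 * (n4 choose 2)"
    have e: "e = 4 * (n1 + n2 + n3 + n4 choose 2) + c"
      by (simp add: e_def c_def choose_two_add algebra_simps)
    have w0: "w 0 (n1, n2, n3, n4) * q ^ c = q ^ e"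
      by (simp add: w_def e power_add power_mult)
    have w2: "w 2 (n1, n2, n3, n4) = w 0 (n1, n2, n3, n4) * q ^ (8 * (n1 + n2 + n3 + n4))"
      by (simp add: w_def power_add power_mult[symmetric])
    have F: "F (n1, n2, n3, n4) = x ^ (n1 + n2 + 2 * n4) * y ^ (n2 + n3) * q ^ l * r * q ^ c"
      by (simp add: F_def r_def l_def c_def euler1_def euler2_def power_add power_mult_distrib
          power_mult[symmetric] mult_ac)
    have "w 0 (n1, n2, n3, n4) * F (n1, n2, n3, n4)
        + x ^ 2 * y * q ^ 6 * (w 2 (n1, n2, n3, n4) * F (n1, n2, n3, n4))
      = x ^ (n1 + n2 + 2 * n4) * y ^ (n2 + n3) * q ^ l
          * (1 + x ^ 2 * y * q ^ (6 + 8 * (n1 + n2 + n3 + n4))) * r * q ^ e"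
      unfolding F w2 w0[symmetric] power_add[of q 6] by (simp only: algebra_simps mult_1_left mult_1_right)
    thus "w 0 (n1, n2, n3, n4) * F (n1, n2, n3, n4)
        + x ^ 2 * y * q ^ 6 * (w 2 (n1, n2, n3, n4) * F (n1, n2, n3, n4))
      = x ^ (n1 + n2 + 2 * n4) * y ^ (n2 + n3) * q ^ (n1 + 3 * n2 + 2 * n3 + 4 * n4)
           * (1 + x ^ 2 * y * q ^ (6 + 8 * (n1 + n2 + n3 + n4)))
         / (qpoch (q ^ 2) (q ^ 2) (enat n1) * qpoch (q ^ 2) (q ^ 2) (enat n2)
            * qpoch (q ^ 4) (q ^ 4) (enat n3) * qpoch (q ^ 4) (q ^ 4) (enat n4))
         * q ^ (4 * (n1 choose 2) + 6 * (n2 choose 2) + 4 * (n3 choose 2) + 8 * (n4 choose 2)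
                + 4 * n1 * n2 + 4 * n1 * n3 + 4 * n1 * n4
                + 4 * n2 * n3 + 4 * n2 * n4 + 4 * n3 * n4)"
      unfolding q_def fps3_divide_rpoch unfolding q_def[symmetric]
      by (simp only: r_def l_def e_def mult.assoc)
  qed
  also have "quad_sum x y = qpoch (- x * q) (q ^ 2) \<infinity> * qpoch (- y * q ^ 2) (q ^ 4) \<infinity>"
    unfolding q_def by (rule quad_sum_eq_qpoch)
  finally show ?thesis .
qed

end
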